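(* Let $k\ge 2$ be an integer and let $q\in\mathbb{C}\setminus\{0\}$ satisfy $q^n\neq1$ for all $n\in\mathbb{N}$. Let $\{p_n(x)\}_{n\ge0}$ and $\{q_n(x)\}_{n\ge0}$ be monic orthogonal polynomial sequences (OPS) satisfying $$p_{nk}(x)=q_n(x^k),\qquad n=0,1,2,\ldots.$$ Then the following holds: (i) If $\{p_n(x)\}_{n\ge0}$ is $H_q$-semiclassical of class $s$, then $\{q_n(x)\}_{n\ge0}$ is $H_{q^k}$-semiclassical of class $\widetilde{s}$, with $\widetilde{s}\le\lfloor s/k\rfloor$. (ii) If $\{q_n(x)\}_{n\ge0}$ is $H_{q^k}$-semiclassical of class $\widetilde{s}$, then $\{p_n(x)\}_{n\ge0}$ is $H_q$-semiclassical of class $s$, with $s\le(\widetilde{s}+3)k-3$.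
   Context: $\mathcal{P}$ is the vector space of polynomials in one variable with complex coefficients, $\mathcal{P}^*$ its algebraic dual, $\langle\mathbf{u},f\rangle$ the action of $\mathbf{u}\in\mathcal{P}^*$ on $f\in\mathcal{P}$; $\mathbb{N}=\{1,2,\ldots\}$. OPS: a sequence $\{p_n\}_{n\ge0}$ in $\mathcal{P}$ is an OPS with respect to $\mathbf{u}\in\mathcal{P}^*$ if $\deg p_n=n$ for all $n\ge 0$ and $\langle\mathbf{u},p_np_m\rangle=k_n\delta_{n,m}$ for all $n,m\ge 0$ with all $k_n\in\mathbb{C}\setminus\{0\}$; in that case $\mathbf{u}$ is called regular. A sequence is an OPS if it is an OPS with respect to some $\mathbf{u}\in\mathcal{P}^*$ (which is then unique up to a nonzero constant factor). For $r\in\mathbb{C}\setminus\{0\}$ with $r^n\ne1$ for all $n\in\mathbb{N}$, the Hahn operator $H_r:\mathcal{P}\to\mathcal{P}$ is $(H_rf)(x)=\frac{f(rx)-f(x)}{(r-1)x}$. On functionals: $\langle H_r\mathbf{u},f\rangle=-\langle\mathbf{u},H_rf\rangle$. For $\phi\in\mathcal{P}$, $\phi\mathbf{u}$ is defined by $\langle\phi\mathbf{u},f\rangle=\langle\mathbf{u},\phi f\rangle$. A functional $\mathbf{u}$ is $H_r$-semiclassical if it is regular and there exist nonzero polynomials $\Phi,\Psi$ with $\deg\Psi\ge1$ such that $H_r(\Phi\mathbf{u})=\Psi\mathbf{u}$. Its class is the minimum of $\max\{\deg\Phi-2,\deg\Psi-1\}$ over all such pairs $(\Phi,\Psi)$ (a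 nonnegative integer). An OPS with respect to an $H_r$-semiclassical functional (of class $s$) is called an $H_r$-semiclassical OPS (of class $s$). *)

theory Defs
  imports Complex_Main "HOL-Computational_Algebra.Polynomial"
begin

(* Elements of the algebraic dual are functions u on complex polynomials that satisfy this
   predicate. *)
definition linear_functional :: "(complex poly \<Rightarrow> complex) \<Rightarrow> bool" where
  "linear_functional u \<longleftrightarrow> Vector_Spaces.linear smult (*) u"

lemma linear_functional_iff:
  "linear_functional u \<longleftrightarrow>
     (\<forall>f g. u (f + g) = u f + u g) \<and> (\<forall>c f. u (smult c f) = c * u f)"
  unfolding linear_functional_def Vector_Spaces.linear_def module_hom_def
    vector_space_def module_def module_hom_axioms_def
  by (auto simp: smult_add_right smult_add_left algebra_simps)

definition ops_wrt :: "(complex poly \<Rightarrow> complex) \<Rightarrow> (nat \<Rightarrow> complex poly) \<Rightarrow> bool" where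
  "ops_wrt u p \<longleftrightarrow> linear_functional u \<and> (\<forall>n. degree (p n) = n) \<and>
     (\<exists>\<kappa> :: nat \<Rightarrow> complex. (\<forall>n. \<kappa> n \<noteq> 0) \<and>
        (\<forall>n m. u (p n * p m) = (if n = m then \<kappa> n else 0)))"

definition regular :: "(complex poly \<Rightarrow> complex) \<Rightarrow> bool" where
  "regular u \<longleftrightarrow> (\<exists>p. ops_wrt u p)"

definition is_ops :: "(nat \<Rightarrow> complex poly) \<Rightarrow> bool" where
  "is_ops p \<longleftrightarrow> (\<exists>u. ops_wrt u p)"

definition monic_ops :: "(nat \<Rightarrow> complex poly) \<Rightarrow> bool" where
  "monic_ops p \<longleftrightarrow> is_ops p \<and> (\<forall>n. lead_coeff (p n) = 1)"

(* (f(r x) - f(x)) / ((r - 1) x); the division is exact, see hahn_mult and poly_hahn below. *)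
definition hahn :: "complex \<Rightarrow> complex poly \<Rightarrow> complex poly" where
  "hahn r f = (pcompose f [:0, r:] - f) div [:0, r - 1:]"

lemma hahn_mult:
  assumes "r \<noteq> 1"
  shows "[:0, r - 1:] * hahn r f = pcompose f [:0, r:] - f"
proof -
  have "poly (pcompose f [:0, r:] - f) 0 = 0"
    by (simp add: poly_pcompose)
  then have "[:0, 1:] dvd pcompose f [:0, r:] - f"
    using poly_eq_0_iff_dvd[of "pcompose f [:0, r:] - f" 0] by simp
  moreover have "[:0, r - 1:] = smult (r - 1) [:0, 1:]"
    by simp
  ultimately have "[:0, r - 1:] dvd pcompose f [:0, r:] - f"
    using assms by (metis smult_dvd right_minus_eq)
  then show ?thesis
    by (simp only: hahn_def dvd_mult_div_cancel)
qed

lemma poly_hahn: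
  assumes "r \<noteq> 1" "x \<noteq> 0"
  shows "poly (hahn r f) x = (poly f (r * x) - poly f x) / ((r - 1) * x)"
  using arg_cong[OF hahn_mult[OF assms(1), of f], of "\<lambda>g. poly g x"] assms
  by (simp add: poly_pcompose field_simps)

definition hahn_dual :: "complex \<Rightarrow> (complex poly \<Rightarrow> complex) \<Rightarrow> (complex poly \<Rightarrow> complex)" where
  "hahn_dual r u = (\<lambda>f. - u (hahn r f))"

definition poly_mult_functional ::
    "complex poly \<Rightarrow> (complex poly \<Rightarrow> complex) \<Rightarrow> (complex poly \<Rightarrow> complex)" where
  "poly_mult_functional \<phi> u = (\<lambda>f. u (\<phi> * f))"

definition hahn_pair ::
    "complex \<Rightarrow> (complex poly \<Rightarrow> complex) \<Rightarrow> complex poly \<Rightarrow> complex poly \<Rightarrow> bool" where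
  "hahn_pair r u \<Phi> \<Psi> \<longleftrightarrow> \<Phi> \<noteq> 0 \<and> \<Psi> \<noteq> 0 \<and> degree \<Psi> \<ge> 1 \<and>
     hahn_dual r (poly_mult_functional \<Phi> u) = poly_mult_functional \<Psi> u"

definition hahn_semiclassical :: "complex \<Rightarrow> (complex poly \<Rightarrow> complex) \<Rightarrow> bool" where
  "hahn_semiclassical r u \<longleftrightarrow> regular u \<and> (\<exists>\<Phi> \<Psi>. hahn_pair r u \<Phi> \<Psi>)"

(* The maximum is taken in the integers, where deg \<Phi> - 2 may be negative; it is nonnegative
   because deg \<Psi> >= 1. The minimum exists whenever u is semiclassical. *)
definition hahn_class :: "complex \<Rightarrow> (complex poly \<Rightarrow> complex) \<Rightarrow> nat" where
  "hahn_class r u = (LEAST s. \<exists>\<Phi> \<Psi>. hahn_pair r u \<Phi> \<Psi> \<and>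
     int s = max (int (degree \<Phi>) - 2) (int (degree \<Psi>) - 1))"

definition hahn_semiclassical_ops :: "complex \<Rightarrow> (nat \<Rightarrow> complex poly) \<Rightarrow> nat \<Rightarrow> bool" where
  "hahn_semiclassical_ops r p s \<longleftrightarrow>
     (\<exists>u. ops_wrt u p \<and> hahn_semiclassical r u \<and> hahn_class r u = s)"

end

theory Submission
  imports Defs
begin

text \<open>
  Orthogonality forces \<open>u(x^j g(x^k)) = c\<^sub>j v(g)\<close> for \<open>j < k\<close> and all \<open>g\<close>, since the left-hand side
  annihilates \<open>q\<^sub>n\<close> for \<open>n \<ge> 1\<close>. For (i), the Hahn equation of \<open>u\<close> is tested on \<open>x^i g(x^k)\<close> with
  \<open>i < k\<close>; each \<open>i\<close> gives an equation for \<open>v\<close>, and regularity of \<open>u\<close> makes one of them nontrivial.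
  For (ii), let \<open>w(f) = v(f\<^bsub>k-1\<^esub>)\<close>, where \<open>f = \<Sum>j<k. x^j f\<^sub>j(x^k)\<close>, and
  \<open>\<rho> = \<Sum>j<k. c\<^sub>j x^(k-1-j)\<close>. Then \<open>u = \<rho> w\<close>, and the Hahn equation of \<open>v\<close> with coefficients
  \<open>A, B\<close> gives one for \<open>w\<close> with coefficients \<open>A(x^k)\<close> and \<open>[k]\<^sub>q x^(k-1) B(x^k)\<close>. Multiplying by
  \<open>\<rho>(x) \<rho>(qx)\<close> produces an equation with \<open>\<Phi> = \<rho>(qx) A(x^k)\<close> for \<open>u\<close>. In both directions only
  \<open>\<Phi> \<noteq> 0\<close> has to be checked: \<open>\<Psi> = 0\<close> contradicts regularity because \<open>H\<^sub>r\<close> is surjective, and a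
  nonzero constant \<open>\<Psi>\<close> contradicts \<open>H\<^sub>r 1 = 0\<close>.
\<close>

text \<open>Many identities below are linear in a polynomial, which leaves only monic monomials to
  check.\<close>

lemma poly_monom_induct:
  fixes R :: "'a::comm_ring_1 poly \<Rightarrow> bool"
  assumes monom: "\<And>n. R (monom 1 n)"
    and add: "\<And>f g. R f \<Longrightarrow> R g \<Longrightarrow> R (f + g)"
    and smult: "\<And>a f. R f \<Longrightarrow> R (smult a f)"
  shows "R f"
proof -
  have zero: "R 0"
    using smult[OF monom, of 0 0] by simp
  have "R (\<Sum>i\<le>N. monom (coeff f i) i)" for N
  proof (induction N)
    case 0
    show ?case using smult[OF monom, of "coeff f 0" 0] by (simp add: smult_monom del: monom_0 monom_eq_1)
  next
    case (Suc N)
    show ?case using add[OF Suc smult[OF monom, of "coeff f (Suc N)" "Suc N"]]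
      by (simp add: smult_monom)
  qed
  then show ?thesis
    by (metis poly_as_sum_of_monoms)
qed

lemma pcompose_monom_monom: "pcompose (monom 1 m) (monom 1 k) = monom (1::'a::comm_ring_1) (m * k)"
  by (simp add: pcompose_altdef poly_monom map_poly_monom monom_power mult.commute)

section \<open>Linear functionals and orthogonal polynomial sequences\<close>

lemma linear_functional_add: "linear_functional u \<Longrightarrow> u (f + g) = u f + u g"
  and linear_functional_smult: "linear_functional u \<Longrightarrow> u (smult a f) = a * u f"
  by (simp_all add: linear_functional_iff)

lemma linear_functional_0: "linear_functional u \<Longrightarrow> u 0 = 0"
  using linear_functional_smult[of u 0 0] by simp

lemma linear_functional_minus: "linear_functional u \<Longrightarrow> u (- f) = - u f"
  using linear_functional_smult[of u "-1" f] by simp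

lemma linear_functional_diff: "linear_functional u \<Longrightarrow> u (f - g) = u f - u g"
  using linear_functional_add[of u f "- g"] by (simp add: linear_functional_minus)

lemma linear_functional_sum: "linear_functional u \<Longrightarrow> u (\<Sum>i\<in>I. f i) = (\<Sum>i\<in>I. u (f i))"
  by (induction I rule: infinite_finite_induct)
    (simp_all add: linear_functional_0 linear_functional_add)

lemmas linear_functional_simps =
  linear_functional_add linear_functional_smult linear_functional_minus linear_functional_diff

lemma ops_wrtD:
  assumes "ops_wrt u p"
  shows "linear_functional u" "degree (p n) = n" "u (p n * p n) \<noteq> 0"
    "n \<noteq> m \<Longrightarrow> u (p n * p m) = 0"
  using assms by (auto simp: ops_wrt_def)

text \<open>There is one \<open>p i\<close> in each degree, so leading coefficients can be removed
  one after another.\<close>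

lemma ops_wrt_expand:
  assumes p: "ops_wrt u p" and "degree f \<le> N"
  shows "\<exists>a. f = (\<Sum>i\<le>N. smult (a i) (p i))"
  using assms(2)
proof (induction N arbitrary: f)
  have nz: "p n \<noteq> 0" for n
    using ops_wrtD(3)[OF p, of n] linear_functional_0[OF ops_wrtD(1)[OF p]] by auto
  note deg = ops_wrtD(2)[OF p]
  {
    case 0
    obtain b where b: "p 0 = [:b:]" using deg[of 0] by (metis degree_eq_zeroE)
    obtain d where d: "f = [:d:]" using 0 by (metis degree_eq_zeroE le_zero_eq)
    have "b \<noteq> 0" using nz[of 0] b by auto
    then have "f = (\<Sum>i\<le>0. smult (d / b) (p i))" by (simp add: b d)
    then show ?case by (intro exI[of _ "\<lambda>_. d / b"])
  next
    case (Suc N)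
    define d where "d = coeff f (Suc N) / coeff (p (Suc N)) (Suc N)"
    define g where "g = f - smult d (p (Suc N))"
    have "coeff (p (Suc N)) (Suc N) \<noteq> 0"
      using nz[of "Suc N"] deg[of "Suc N"] by (metis leading_coeff_0_iff)
    then have "coeff g (Suc N) = 0" by (simp add: g_def d_def)
    moreover have "degree g \<le> Suc N"
      unfolding g_def using Suc.prems deg[of "Suc N"]
      by (intro degree_diff_le) (auto intro: order_trans[OF degree_smult_le])
    ultimately have "degree g \<le> N"
      by (metis degree_0 le_SucE leading_coeff_0_iff zero_le)
    from Suc.IH[OF this] obtain a where a: "g = (\<Sum>i\<le>N. smult (a i) (p i))" by blast
    have "f = (\<Sum>i\<le>Suc N. smult ((a(Suc N := d)) i) (p i))"
      using a by (simp add: g_def algebra_simps)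
    then show ?case by blast
  }
qed

lemma ops_wrt_orthogonal:
  assumes p: "ops_wrt u p" and "degree f < n"
  shows "u (f * p n) = 0"
proof -
  note lin = ops_wrtD(1)[OF p]
  obtain a where a: "f = (\<Sum>i\<le>degree f. smult (a i) (p i))"
    using ops_wrt_expand[OF p, of f "degree f"] by blast
  have "u (f * p n) = (\<Sum>i\<le>degree f. a i * u (p i * p n))"
    by (subst a) (simp add: sum_distrib_right linear_functional_sum[OF lin]
        linear_functional_smult[OF lin])
  also have "\<dots> = 0"
    using assms(2) by (intro sum.neutral) (auto simp: ops_wrtD(4)[OF p])
  finally show ?thesis .
qed

text \<open>Testing on \<open>h = p j\<close> isolates \<open>a j\<close> times a nonzero number.
  This is how regularity rules out vanishing coefficient polynomials.\<close>

lemma ops_wrt_nondegenerate: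
  assumes p: "ops_wrt u p" and zero: "\<And>h. u (f * h) = 0"
  shows "f = 0"
proof -
  note lin = ops_wrtD(1)[OF p]
  obtain a where a: "f = (\<Sum>i\<le>degree f. smult (a i) (p i))"
    using ops_wrt_expand[OF p, of f "degree f"] by blast
  have "a j = 0" if "j \<le> degree f" for j
  proof -
    have "0 = u (f * p j)" by (simp add: zero)
    also have "\<dots> = (\<Sum>i\<le>degree f. a i * u (p i * p j))"
      by (subst a) (simp add: sum_distrib_right linear_functional_sum[OF lin]
          linear_functional_smult[OF lin])
    also have "\<dots> = (\<Sum>i\<le>degree f. if i = j then a j * u (p j * p j) else 0)"
      by (intro sum.cong) (auto simp: ops_wrtD(4)[OF p])
    also have "\<dots> = a j * u (p j * p j)" using that by simp
    finally show ?thesis using ops_wrtD(3)[OF p] by simp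
  qed
  then have "(\<Sum>i\<le>degree f. smult (a i) (p i)) = 0" by (intro sum.neutral) auto
  then show ?thesis using a by simp
qed

lemma ops_wrt_zeroth: "ops_wrt u p \<Longrightarrow> p 0 = 1 \<Longrightarrow> u 1 \<noteq> 0"
  using ops_wrtD(3)[of u p 0] by simp

text \<open>A functional that kills every \<open>p n\<close> with \<open>n \<noteq> 0\<close> sees
  only the coefficient of \<open>p 0 = 1\<close>. Both \<open>L\<close> and \<open>u\<close> are of
  this kind, so they are proportional, and the value at \<open>1\<close> fixes the factor.\<close>

lemma ops_wrt_functional_unique:
  assumes p: "ops_wrt u p" "p 0 = 1" and L: "linear_functional L"
    and zero: "\<And>n. n \<noteq> 0 \<Longrightarrow> L (p n) = 0"
  shows "L f = L 1 / u 1 * u f"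
proof -
  note lin = ops_wrtD(1)[OF p(1)]
  obtain a where a: "f = (\<Sum>i\<le>degree f. smult (a i) (p i))"
    using ops_wrt_expand[OF p(1), of f "degree f"] by blast
  have *: "M f = a 0 * M 1"
    if M: "linear_functional M" "\<And>n. n \<noteq> 0 \<Longrightarrow> M (p n) = 0" for M
  proof -
    have "M f = (\<Sum>i\<le>degree f. a i * M (p i))"
      by (subst a) (simp add: linear_functional_sum[OF M(1)] linear_functional_smult[OF M(1)])
    also have "\<dots> = (\<Sum>i\<le>degree f. if i = 0 then a 0 * M 1 else 0)"
      by (intro sum.cong) (auto simp: M(2) p(2))
    also have "\<dots> = a 0 * M 1" by simp
    finally show ?thesis .
  qed
  have "u (p n) = 0" if "n \<noteq> 0" for n
    using ops_wrtD(4)[OF p(1), of 0 n] that p(2) by simp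
  then show ?thesis
    using *[OF L zero] *[OF lin] ops_wrt_zeroth[OF p] by simp
qed

section \<open>The Hahn operator\<close>

lemma hahn_eqI:
  assumes "r \<noteq> 1" "[:0, r - 1:] * g = pcompose f [:0, r:] - f"
  shows "hahn r f = g"
proof -
  have "[:0, r - 1:] * hahn r f = [:0, r - 1:] * g"
    using hahn_mult[OF assms(1)] assms(2) by simp
  moreover have "[:0, r - 1:] \<noteq> 0" using assms(1) by simp
  ultimately show ?thesis using mult_cancel_left by blast
qed

lemma hahn_add: "r \<noteq> 1 \<Longrightarrow> hahn r (f + g) = hahn r f + hahn r g"
  by (rule hahn_eqI) (simp_all del: mult_pCons_left add: distrib_left hahn_mult pcompose_add)

lemma hahn_smult: "r \<noteq> 1 \<Longrightarrow> hahn r (smult a f) = smult a (hahn r f)"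
  by (rule hahn_eqI) (simp_all del: mult_pCons_left add: hahn_mult pcompose_smult smult_diff_right)

lemma hahn_0: "hahn r 0 = 0"
  by (simp add: hahn_def)

text \<open>Twisted Leibniz rule: add and subtract f(rx) g(x) in the difference f(rx) g(rx) - f(x)
  g(x).\<close>

lemma hahn_mult_rule:
  "r \<noteq> 1 \<Longrightarrow> hahn r (f * g) = pcompose f [:0, r:] * hahn r g + hahn r f * g"
proof (rule hahn_eqI)
  assume r: "r \<noteq> 1"
  have "[:0, r - 1:] * (pcompose f [:0, r:] * hahn r g + hahn r f * g)
    = pcompose f [:0, r:] * ([:0, r - 1:] * hahn r g) + ([:0, r - 1:] * hahn r f) * g"
    by (simp only: algebra_simps)
  also have "\<dots> = pcompose (f * g) [:0, r:] - f * g"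
    unfolding hahn_mult[OF r] pcompose_mult by (simp only: algebra_simps)
  finally show "[:0, r - 1:] * (pcompose f [:0, r:] * hahn r g + hahn r f * g)
    = pcompose (f * g) [:0, r:] - f * g" .
qed

text \<open>The q-integer [n]_r = 1 + r + ... + r^(n-1) for \<open>r \<noteq> 1\<close>, the factor
  that the Hahn operator produces on x^n.\<close>

definition q_number :: "complex \<Rightarrow> nat \<Rightarrow> complex" where
  "q_number r n = (r ^ n - 1) / (r - 1)"

lemma q_number_0 [simp]: "q_number r 0 = 0"
  by (simp add: q_number_def)

lemma q_number_add: "q_number r (m + n) = q_number r m + r ^ m * q_number r n"
  by (simp add: q_number_def power_add diff_divide_distrib algebra_simps)

lemma q_number_mult:
  "r ^ k \<noteq> 1 \<Longrightarrow> q_number r (m * k) = q_number r k * q_number (r ^ k) m"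
  by (simp add: q_number_def power_mult[symmetric] mult.commute)

lemma q_number_nonzero: "r ^ n \<noteq> 1 \<Longrightarrow> q_number r n \<noteq> 0"
  by (cases "r = 1") (auto simp: q_number_def)

lemma hahn_monom: "r \<noteq> 1 \<Longrightarrow> hahn r (monom a n) = monom (q_number r n * a) (n - 1)"
proof (rule hahn_eqI)
  assume r: "r \<noteq> 1"
  have *: "[:0, r - 1:] = monom (r - 1) 1" "[:0, r:] = monom r 1"
    by (simp_all add: monom_altdef)
  have "pcompose (monom a n) [:0, r:] = monom (a * r ^ n) n"
    unfolding * by (simp add: pcompose_altdef poly_monom map_poly_monom monom_power smult_monom)
  then show "[:0, r - 1:] * monom (q_number r n * a) (n - 1) = pcompose (monom a n) [:0, r:] - monom a n"
    using r unfolding * by (cases n) (simp_all add: mult_monom diff_monom q_number_def field_simps)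
qed

lemma hahn_1: "r \<noteq> 1 \<Longrightarrow> hahn r 1 = 0"
  using hahn_monom[of r 1 0] by simp

lemma degree_hahn_le: "r \<noteq> 1 \<Longrightarrow> degree (hahn r f) \<le> degree f - 1"
proof (cases "hahn r f = 0")
  case False
  assume r: "r \<noteq> 1"
  have "Suc (degree (hahn r f)) = degree ([:0, r - 1:] * hahn r f)"
    using False r by (subst degree_mult_eq) auto
  also have "\<dots> \<le> degree f"
    unfolding hahn_mult[OF r] by (intro degree_diff_le) (auto simp: degree_pcompose)
  finally show ?thesis by simp
qed simp

text \<open>x^n is the image of x^(n+1) / [n+1]_r; the division is possible because \<open>r\<close>
  is not a root of unity.\<close>

lemma hahn_surj:
  assumes "\<forall>n\<ge>1. r ^ n \<noteq> 1"
  shows "\<exists>f. hahn r f = g"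
proof (induction g rule: poly_monom_induct)
  have r: "r \<noteq> 1" using assms[rule_format, of 1] by simp
  {
    case (1 n)
    have "q_number r (Suc n) \<noteq> 0" using assms by (intro q_number_nonzero) (metis le_add1 plus_1_eq_Suc)
    then have "hahn r (monom (1 / q_number r (Suc n)) (Suc n)) = monom 1 n"
      by (simp add: hahn_monom[OF r])
    then show ?case by blast
  next
    case (2 f g)
    then show ?case using hahn_add[OF r] by metis
  next
    case (3 a f)
    then show ?case using hahn_smult[OF r] by metis
  }
qed

section \<open>Hahn pairs and the class\<close>

lemma hahn_pair_iff:
  "hahn_pair r u \<Phi> \<Psi> \<longleftrightarrow> \<Phi> \<noteq> 0 \<and> \<Psi> \<noteq> 0 \<and> degree \<Psi> \<ge> 1 \<and>
     (\<forall>f. u (\<Phi> * hahn r f) = - u (\<Psi> * f))"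
  by (simp add: hahn_pair_def hahn_dual_def poly_mult_functional_def fun_eq_iff)
    (metis minus_minus)

lemma hahn_pairI:
  assumes r: "\<forall>n\<ge>1. r ^ n \<noteq> 1" and p: "ops_wrt u p" "p 0 = 1" and "\<Phi> \<noteq> 0"
    and eq: "\<And>f. u (\<Phi> * hahn r f) = - u (\<Psi> * f)"
  shows "hahn_pair r u \<Phi> \<Psi>"
proof -
  have r1: "r \<noteq> 1" using r[rule_format, of 1] by simp
  note lin = ops_wrtD(1)[OF p(1)]
  have nz: "\<Psi> \<noteq> 0"
  proof
    assume "\<Psi> = 0"
    then have "u (\<Phi> * hahn r f) = 0" for f
      by (simp add: eq linear_functional_0[OF lin])
    then have "u (\<Phi> * h) = 0" for h using hahn_surj[OF r, of h] by auto
    with ops_wrt_nondegenerate[OF p(1)] \<open>\<Phi> \<noteq> 0\<close> show False by blast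
  qed
  moreover have "degree \<Psi> \<noteq> 0"
  proof
    assume "degree \<Psi> = 0"
    then obtain b where b: "\<Psi> = [:b:]" by (metis degree_eq_zeroE)
    have "u \<Psi> = 0" using eq[of 1] by (simp add: hahn_1[OF r1] linear_functional_0[OF lin])
    moreover have "u \<Psi> = b * u 1"
      using linear_functional_smult[OF lin, of b 1] b by simp
    ultimately show False using nz b ops_wrt_zeroth[OF p] by simp
  qed
  ultimately show ?thesis using \<open>\<Phi> \<noteq> 0\<close> eq by (simp add: hahn_pair_iff)
qed

lemma hahn_class_witness:
  assumes "hahn_semiclassical r u"
  obtains \<Phi> \<Psi> where "hahn_pair r u \<Phi> \<Psi>"
    "degree \<Phi> \<le> hahn_class r u + 2" "degree \<Psi> \<le> hahn_class r u + 1"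
proof -
  obtain \<Phi> \<Psi> where pair: "hahn_pair r u \<Phi> \<Psi>"
    using assms by (auto simp: hahn_semiclassical_def)
  \<comment> \<open>The maximum is nonnegative because \<open>degree \<Psi> \<ge> 1\<close>, so
    passing to \<open>nat\<close> loses nothing and the set behind \<open>LEAST\<close> is
    nonempty.\<close>
  have "int (nat (max (int (degree \<Phi>) - 2) (int (degree \<Psi>) - 1)))
    = max (int (degree \<Phi>) - 2) (int (degree \<Psi>) - 1)"
    using pair unfolding hahn_pair_def by linarith
  then have "\<exists>s \<Phi> \<Psi>. hahn_pair r u \<Phi> \<Psi> \<and> int s = max (int (degree \<Phi>) - 2) (int (degree \<Psi>) - 1)"
    using pair by blast
  from LeastI_ex[OF this] obtain \<Phi> \<Psi> where "hahn_pair r u \<Phi> \<Psi>"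
    "int (hahn_class r u) = max (int (degree \<Phi>) - 2) (int (degree \<Psi>) - 1)"
    unfolding hahn_class_def by blast
  then show thesis by (intro that[of \<Phi> \<Psi>]) linarith+
qed

lemma hahn_class_le:
  assumes "hahn_pair r u \<Phi> \<Psi>" "degree \<Phi> \<le> s + 2" "degree \<Psi> \<le> s + 1"
  shows "hahn_class r u \<le> s"
proof -
  define t where "t = nat (max (int (degree \<Phi>) - 2) (int (degree \<Psi>) - 1))"
  have "int t = max (int (degree \<Phi>) - 2) (int (degree \<Psi>) - 1)"
    using assms(1) unfolding t_def hahn_pair_def by linarith
  moreover from this have "t \<le> s" using assms(2,3) by linarith
  moreover from calculation assms(1) have "hahn_class r u \<le> t"
    unfolding hahn_class_def by (intro Least_le) blast
  ultimately show ?thesis by simp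
qed

lemma hahn_semiclassical_opsI:
  assumes r: "\<forall>n\<ge>1. r ^ n \<noteq> 1" and p: "ops_wrt u p" "p 0 = 1" and "\<Phi> \<noteq> 0"
    and eq: "\<And>f. u (\<Phi> * hahn r f) = - u (\<Psi> * f)"
    and deg: "degree \<Phi> \<le> s + 2" "degree \<Psi> \<le> s + 1"
  shows "\<exists>t\<le>s. hahn_semiclassical_ops r p t"
proof -
  have "hahn_pair r u \<Phi> \<Psi>" using hahn_pairI[OF r p \<open>\<Phi> \<noteq> 0\<close> eq] .
  then have "hahn_class r u \<le> s" "hahn_semiclassical_ops r p (hahn_class r u)"
    using hahn_class_le[OF _ deg] p
    by (auto simp: hahn_semiclassical_ops_def hahn_semiclassical_def regular_def)
  then show ?thesis by blast
qed

section \<open>Weighted sections of a polynomial\<close>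

text \<open>If \<open>f(x) = \<Sum>j<k. x^j f\<^sub>j(x^k)\<close>, this is \<open>\<Sum>j<k. c\<^sub>j f\<^sub>j\<close>.\<close>

definition section_sum :: "nat \<Rightarrow> (nat \<Rightarrow> 'a) \<Rightarrow> 'a::comm_ring_1 poly \<Rightarrow> 'a poly" where
  "section_sum k c f = (\<Sum>i\<le>degree f. monom (coeff f i * c (i mod k)) (i div k))"

lemma section_sum_eq:
  "degree f \<le> N \<Longrightarrow> section_sum k c f = (\<Sum>i\<le>N. monom (coeff f i * c (i mod k)) (i div k))"
  unfolding section_sum_def by (intro sum.mono_neutral_left) (auto simp: coeff_eq_0)

lemma section_sum_add: "section_sum k c (f + g) = section_sum k c f + section_sum k c g"
  by (simp add: section_sum_eq[of _ "max (degree f) (degree g)"] degree_add_le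
      sum.distrib[symmetric] add_monom distrib_right)

lemma section_sum_smult: "section_sum k c (smult a f) = smult a (section_sum k c f)"
proof -
  have "smult a (section_sum k c f) = [:a:] * section_sum k c f" by simp
  also have "\<dots> = section_sum k c (smult a f)"
    unfolding section_sum_def[of k c f] section_sum_eq[OF degree_smult_le] sum_distrib_left
    by (simp add: smult_monom mult.assoc)
  finally show ?thesis by simp
qed

lemma section_sum_monom:
  "section_sum k c (monom a n) = monom (a * c (n mod k)) (n div k)"
proof -
  have "section_sum k c (monom a n)
    = (\<Sum>i\<le>n. if i = n then monom (a * c (n mod k)) (n div k) else 0)"
    by (subst section_sum_eq[OF degree_monom_le]) (auto intro!: sum.cong simp del: sum.delta sum.delta')
  then show ?thesis by simp
qed

lemma degree_section_sum_le: "degree (section_sum k c f) \<le> degree f div k"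
  unfolding section_sum_def
  by (intro degree_sum_le) (auto intro!: order_trans[OF degree_monom_le] div_le_mono)

lemmas section_sum_simps = section_sum_add section_sum_smult section_sum_monom

text \<open>Multiplication by g(x^k) preserves exponents modulo \<open>k\<close>, so it multiplies
  each component f_j by g.\<close>

lemma section_sum_mult_pcompose:
  assumes "k > 0"
  shows "section_sum k c (f * pcompose g (monom 1 k)) = section_sum k c f * g"
proof (induction f rule: poly_monom_induct)
  case (1 n)
  show ?case
  proof (induction g rule: poly_monom_induct)
    case (1 m)
    show ?case using assms
      by (simp add: pcompose_monom_monom mult_monom section_sum_monom add.commute)
  qed (simp_all add: pcompose_add pcompose_smult section_sum_simps distrib_left)
qed (simp_all add: section_sum_simps distrib_right)

text \<open>Twisted Leibniz rule for x^i and g(x^k), combined with the chain rule H_q(g(x^k)) =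
  [k]_q x^(k-1) (H_{q^k} g)(x^k). On monomials it becomes [i+mk]_q = [i]_q + q^i [k]_q
  [m]_{q^k}.\<close>

lemma hahn_pcompose_monom:
  assumes "q \<noteq> 1" "q ^ k \<noteq> 1"
  shows "hahn q (monom 1 i * pcompose g (monom 1 k)) =
    smult (q_number q i) (monom 1 (i - 1) * pcompose g (monom 1 k)) +
    smult (q ^ i * q_number q k) (monom 1 (k + i - 1) * pcompose (hahn (q ^ k) g) (monom 1 k))"
proof (induction g rule: poly_monom_induct)
  case (1 m)
  have mono: "pcompose (monom a n) (monom 1 k) = monom a (n * k)" for a :: complex and n
    using arg_cong[OF pcompose_monom_monom[of n k], of "smult a"]
    by (simp flip: pcompose_smult add: smult_monom)
  have k: "k > 0" using assms by (intro gr0I) auto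
  show ?case
  proof (cases m)
    case 0
    then show ?thesis
      by (simp add: hahn_monom hahn_1 assms smult_monom pcompose_1)
  next
    case (Suc l)
    have e: "k + i - 1 + l * k = i + m * k - 1" using k Suc by simp
    have d: "i \<noteq> 0 \<Longrightarrow> i - 1 + m * k = i + m * k - 1" by simp
    have "hahn q (monom 1 i * pcompose (monom 1 m) (monom 1 k))
      = monom (q_number q (i + m * k)) (i + m * k - 1)"
      by (simp add: mono hahn_monom assms mult_monom)
    also have "\<dots> = monom (q_number q i) (i + m * k - 1) +
        monom (q ^ i * q_number q k * q_number (q ^ k) m) (i + m * k - 1)"
      by (simp only: q_number_add q_number_mult[OF assms(2)] add_monom mult.assoc)
    \<comment> \<open>Truncation of \<open>i - 1\<close> at \<open>i = 0\<close> is harmless, since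
      the coefficient [0]_q vanishes.\<close>
    also have "monom (q_number q i) (i + m * k - 1) = monom (q_number q i) (i - 1 + m * k)"
      by (cases "i = 0") (simp_all only: d q_number_0 monom_0 monom_eq_0 not_False_eq_True)
    also have "i + m * k - 1 = k + i - 1 + (m - 1) * k" using e Suc by simp
    finally show ?thesis
      by (simp only: mono hahn_monom assms not_False_eq_True mult_monom smult_monom mult_1_right mult_1_left)
  qed
next
  case (2 f g)
  then show ?case using assms
    by (simp add: hahn_add pcompose_add distrib_left smult_add_right)
next
  case (3 a f)
  then show ?case using assms
    by (simp add: hahn_smult pcompose_smult smult_add_right mult.commute)
qed

section \<open>Functionals related by the substitution of the k-th power\<close>

text \<open>Only the relation between the two functionals is recorded; orthogonality enters later as
  a hypothesis on \<open>u\<close> or \<open>v\<close>, so one setting serves both directions.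
  Taking g = 1 in \<open>rel\<close> shows that \<open>c j\<close> is the moment u(x^j) divided by
  v(1).\<close>

locale power_related_functionals =
  fixes k :: nat and q :: complex and c :: "nat \<Rightarrow> complex"
    and u v :: "complex poly \<Rightarrow> complex"
  assumes k: "k > 0" and q0: "q \<noteq> 0" and q: "\<forall>n\<ge>1. q ^ n \<noteq> 1"
    and u: "linear_functional u" and v: "linear_functional v"
    and c0: "c 0 \<noteq> 0"
    and rel: "j < k \<Longrightarrow> u (monom 1 j * pcompose g (monom 1 k)) = c j * v g"
begin

lemma q1: "q \<noteq> 1" and qk1: "q ^ k \<noteq> 1" and qk: "\<forall>n\<ge>1. (q ^ k) ^ n \<noteq> 1"
  using q[rule_format, of 1] q k by (auto simp flip: power_mult)

lemma u_section_sum: "u f = v (section_sum k c f)"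
proof (induction f rule: poly_monom_induct)
  case (1 n)
  have "monom 1 n = monom 1 (n mod k) * pcompose (monom 1 (n div k)) (monom (1::complex) k)"
    by (simp add: pcompose_monom_monom mult_monom)
  then have "u (monom 1 n) = c (n mod k) * v (monom 1 (n div k))"
    using rel[of "n mod k" "monom 1 (n div k)"] k by simp
  then show ?case
    using linear_functional_smult[OF v, of "c (n mod k)" "monom 1 (n div k)"]
    by (simp add: section_sum_monom smult_monom)
qed (simp_all add: linear_functional_simps[OF u] linear_functional_simps[OF v] section_sum_simps)

lemma u_mult_pcompose: "u (f * pcompose g (monom 1 k)) = v (section_sum k c f * g)"
  by (simp add: u_section_sum section_sum_mult_pcompose[OF k])

section \<open>Part (i): descent from \<open>u\<close> to \<open>v\<close>\<close>

lemma semiclassical_descent: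
  assumes p: "ops_wrt u p" and Q: "ops_wrt v Q" "Q 0 = 1"
    and "\<Phi> \<noteq> 0" and eq: "\<And>f. u (\<Phi> * hahn q f) = - u (\<Psi> * f)"
    and deg: "degree \<Phi> \<le> s + 2" "degree \<Psi> \<le> s + 1"
  shows "\<exists>t \<le> s div k. hahn_semiclassical_ops (q ^ k) Q t"
proof -
  \<comment> \<open>If all these sections vanished, \<open>u\<close> would annihilate \<Phi> x^(k-1)
    h for every h, because x^(k-1+n) is x^(k+i-1) with \<open>i = n mod k\<close> times a power of
    x^k.\<close>
  have "\<exists>i<k. section_sum k c (\<Phi> * monom 1 (k + i - 1)) \<noteq> 0"
  proof (rule ccontr)
    assume "\<not> ?thesis"
    then have z: "section_sum k c (\<Phi> * monom 1 (k + i - 1)) = 0" if "i < k" for i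
      using that by blast
    have "u (\<Phi> * monom 1 (k - 1) * h) = 0" for h
    proof (induction h rule: poly_monom_induct)
      case (1 n)
      have "monom 1 (k - 1) * monom 1 n
        = monom 1 (k + n mod k - 1) * pcompose (monom 1 (n div k)) (monom (1::complex) k)"
        using k by (simp add: pcompose_monom_monom mult_monom add.commute)
      then have "u (\<Phi> * monom 1 (k - 1) * monom 1 n) =
          v (section_sum k c (\<Phi> * monom 1 (k + n mod k - 1)) * monom 1 (n div k))"
        by (simp only: mult.assoc flip: u_mult_pcompose)
      then show ?case using z[of "n mod k"] k by (simp add: linear_functional_0[OF v])
    qed (simp_all add: distrib_left linear_functional_simps[OF u])
    then have "\<Phi> * monom 1 (k - 1) = 0" by (rule ops_wrt_nondegenerate[OF p])
    with \<open>\<Phi> \<noteq> 0\<close> show False by simp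
  qed
  then obtain i where i: "i < k" "section_sum k c (\<Phi> * monom 1 (k + i - 1)) \<noteq> 0" by blast
  \<comment> \<open>Expanding the equation of \<open>u\<close> on x^i g(x^k) by
    \<open>hahn_pcompose_monom\<close>, the term with H_{q^k} g gives \<open>A\<close>; the others,
    collected on the right-hand side, give \<open>B\<close>.\<close>
  define A where "A = smult (q ^ i * q_number q k) (section_sum k c (\<Phi> * monom 1 (k + i - 1)))"
  define B where "B = section_sum k c (\<Psi> * monom 1 i + smult (q_number q i) (\<Phi> * monom 1 (i - 1)))"
  have "A \<noteq> 0" using i q0 q_number_nonzero[OF qk1] by (simp add: A_def)
  moreover have "v (A * hahn (q ^ k) g) = - v (B * g)" for g
  proof -
    have "u (\<Phi> * hahn q (monom 1 i * pcompose g (monom 1 k))) =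
       q_number q i * u (\<Phi> * monom 1 (i - 1) * pcompose g (monom 1 k)) + v (A * hahn (q ^ k) g)"
      unfolding hahn_pcompose_monom[OF q1 qk1]
      by (simp add: distrib_left linear_functional_simps[OF u] linear_functional_simps[OF v]
          A_def u_mult_pcompose flip: mult.assoc)
    moreover have "v (B * g) = u (\<Psi> * monom 1 i * pcompose g (monom 1 k)) +
       q_number q i * u (\<Phi> * monom 1 (i - 1) * pcompose g (monom 1 k))"
      by (simp add: B_def section_sum_simps u_mult_pcompose distrib_right
          linear_functional_simps[OF v])
    ultimately show ?thesis
      using eq[of "monom 1 i * pcompose g (monom 1 k)"] by (simp add: mult.assoc add_eq_0_iff)
  qed
  moreover have "degree A \<le> s div k + 2"
  proof -
    have "degree (\<Phi> * monom 1 (k + i - 1)) \<le> s + 2 + (k + i - 1)"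
      by (intro order_trans[OF degree_mult_le] add_mono deg degree_monom_le)
    \<comment> \<open>Since \<open>i \<le> k - 1\<close>, the excess over \<open>s\<close> is at
      most 2k, which division by \<open>k\<close> turns into exactly 2.\<close>
    also have "\<dots> \<le> s + 2 * k" using i(1) by simp
    finally have "degree (section_sum k c (\<Phi> * monom 1 (k + i - 1))) \<le> (s + 2 * k) div k"
      by (intro order_trans[OF degree_section_sum_le] div_le_mono)
    then show ?thesis
      unfolding A_def using k by (intro order_trans[OF degree_smult_le]) simp
  qed
  moreover have "degree B \<le> s div k + 1"
  proof -
    have "degree (\<Psi> * monom 1 i) \<le> s + 1 + i"
      by (intro order_trans[OF degree_mult_le] add_mono deg degree_monom_le)
    moreover have "degree (smult (q_number q i) (\<Phi> * monom 1 (i - 1))) \<le> s + 1 + i"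
    proof (cases i)
      case (Suc l)
      have "degree (\<Phi> * monom 1 l) \<le> s + 2 + l"
        by (intro order_trans[OF degree_mult_le] add_mono deg degree_monom_le)
      then show ?thesis using Suc by (intro order_trans[OF degree_smult_le]) simp
    qed simp
    ultimately have "degree (\<Psi> * monom 1 i + smult (q_number q i) (\<Phi> * monom 1 (i - 1))) \<le> s + 1 + i"
      by (rule degree_add_le)
    also have "\<dots> \<le> s + k" using i(1) by simp
    finally have "degree B \<le> (s + k) div k"
      unfolding B_def by (intro order_trans[OF degree_section_sum_le] div_le_mono)
    then show ?thesis using k by simp
  qed
  ultimately show ?thesis by (rule hahn_semiclassical_opsI[OF qk Q])
qed

section \<open>Part (ii): ascent from \<open>v\<close> to \<open>u\<close> through
  \<open>w\<close>\<close>

definition \<rho> :: "complex poly" where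
  "\<rho> = (\<Sum>j<k. monom (c j) (k - 1 - j))"

text \<open>The functional with formal Stieltjes series S_v(z^k). It is auxiliary: for
  \<open>k \<ge> 2\<close> it vanishes at 1 and so is not regular, but it inherits a Hahn equation
  from \<open>v\<close>, and \<open>u\<close> is a polynomial multiple of it.\<close>

definition w :: "complex poly \<Rightarrow> complex" where
  "w f = v (section_sum k (\<lambda>j. if j = k - 1 then 1 else 0) f)"

lemma linear_w: "linear_functional w"
  by (simp add: linear_functional_iff w_def section_sum_simps linear_functional_simps[OF v])

text \<open>Only \<open>j = 0\<close> reaches the exponent \<open>k - 1\<close>, so the coefficient
  there is \<open>c 0\<close>.\<close>

lemma \<rho>_nonzero: "\<rho> \<noteq> 0"
proof -
  have "coeff \<rho> (k - 1) = (\<Sum>j<k. if j = 0 then c 0 else 0)"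
    unfolding \<rho>_def coeff_sum by (intro sum.cong) (auto simp: coeff_monom)
  then show ?thesis using k c0 by auto
qed

lemma degree_\<rho>: "degree \<rho> \<le> k - 1"
  unfolding \<rho>_def by (intro degree_sum_le) (auto intro!: order_trans[OF degree_monom_le])

text \<open>On the level of formal Stieltjes series, this says \<open>S\<^sub>u(z) = \<rho>(z) S\<^sub>v(z^k)\<close>.\<close>

lemma u_eq_w: "u f = w (\<rho> * f)"
proof (induction f rule: poly_monom_induct)
  case (1 n)
  \<comment> \<open>Exactly one of the \<open>k\<close> exponents has the residue
    \<open>k - 1\<close> that \<open>w\<close> detects, so a single term of \<rho> survives in
    w(\<rho> x^n).\<close>
  have mod_eq: "(k - 1 - j + n) mod k = k - 1 \<longleftrightarrow> j = n mod k" if "j < k" for j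
  proof -
    define m where "m = n div k"
    define i where "i = n mod k"
    have n: "n = m * k + i" and ik: "i < k" using k by (simp_all add: m_def i_def)
    have "(k - 1 - j + n) mod k = (k - 1 - j + i) mod k"
      unfolding n by (metis add.assoc add.commute mod_mult_self1 mult.commute)
    also have "\<dots> = k - 1 \<longleftrightarrow> j = i"
    proof (cases "i \<le> j")
      case True
      then show ?thesis using that by auto
    next
      case False
      then have "k - 1 - j + i = (i - 1 - j) + k" using that ik by simp
      then have "(k - 1 - j + i) mod k = i - 1 - j" using ik by (simp only: mod_add_self2) simp
      then show ?thesis using False ik by auto
    qed
    finally show ?thesis by (simp add: i_def)
  qed
  have "w (\<rho> * monom 1 n) = (\<Sum>j<k. w (monom (c j) (k - 1 - j + n)))"
    by (simp add: \<rho>_def sum_distrib_right mult_monom linear_functional_sum[OF linear_w])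
  also have "\<dots> = (\<Sum>j<k. if j = n mod k then w (monom (c (n mod k)) (k - 1 - n mod k + n)) else 0)"
    using mod_eq
    by (intro sum.cong) (auto simp: w_def section_sum_monom linear_functional_0[OF v])
  also have "\<dots> = w (monom (c (n mod k)) (k - 1 - n mod k + n))"
    using k by simp
  also have "\<dots> = v (monom (c (n mod k)) (n div k))"
  proof -
    have "n mod k < k" using k by simp
    then have "k - 1 - n mod k + n = (k - 1) + k * (n div k)"
      using mult_div_mod_eq[of k n] by linarith
    then have "(k - 1 - n mod k + n) mod k = k - 1" "(k - 1 - n mod k + n) div k = n div k"
      using k by (simp_all only: mod_mult_self2 div_mult_self2) simp_all
    then show ?thesis by (simp add: w_def section_sum_monom)
  qed
  finally show ?case by (simp add: u_section_sum section_sum_monom)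
qed (simp_all add: linear_functional_simps[OF u] linear_functional_simps[OF linear_w] distrib_left)

text \<open>H_q lowers exponents by one, so on the left only the monomials x^(mk) can reach residue
  \<open>k - 1\<close>; the factor x^(k-1) selects the same ones on the right. The coefficients
  agree by [mk]_q = [k]_q [m]_{q^k}, and both sides vanish on 1.\<close>

lemma section_sum_hahn:
  defines "\<delta> \<equiv> \<lambda>j. if j = k - 1 then 1 else (0::complex)"
  shows "section_sum k \<delta> (hahn q f) =
    smult (q_number q k) (hahn (q ^ k) (section_sum k \<delta> (monom 1 (k - 1) * f)))"
proof (induction f rule: poly_monom_induct)
  case (1 n)
  define m where "m = n div k"
  define i where "i = n mod k"
  have n: "n = m * k + i" and ik: "i < k" using k by (simp_all add: m_def i_def)
  show ?case
  proof (cases "i = 0")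
    case True
    show ?thesis
    proof (cases m)
      case 0
      with n True k show ?thesis
        by (simp add: hahn_1 hahn_monom q1 qk1 section_sum_monom section_sum_def[of _ _ 0])
    next
      case (Suc l)
      then have "n - 1 = (k - 1) + k * l" using n True k by (simp add: mult.commute)
      then have 1: "(n - 1) mod k = k - 1" "(n - 1) div k = l"
        using k by (simp_all only: mod_mult_self2 div_mult_self2) simp_all
      have "k - 1 + n = (k - 1) + k * m" using n True by simp
      then have 2: "(k - 1 + n) mod k = k - 1" "(k - 1 + n) div k = m"
        using k by (simp_all only: mod_mult_self2 div_mult_self2) simp_all
      have "q_number q n = q_number q k * q_number (q ^ k) m"
        using q_number_mult[OF qk1] n True by simp
      then show ?thesis
        by (simp add: hahn_monom q1 qk1 section_sum_simps mult_monom smult_monom 1[simplified] 2[simplified] Suc \<delta>_def)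
    qed
  next
    case False
    have "n - 1 = m * k + (i - 1)" "k - 1 + n = Suc m * k + (i - 1)" using n False k by simp_all
    then have "(n - 1) mod k = i - 1" "(k - 1 + n) mod k = i - 1"
      using ik by (simp_all add: mod_mult_self3 del: mult_Suc)
    moreover have "i - 1 \<noteq> k - 1" using False ik by simp
    ultimately show ?thesis
      by (simp add: hahn_0 hahn_monom q1 qk1 section_sum_simps mult_monom smult_monom \<delta>_def)
  qed
qed (simp_all add: hahn_add hahn_smult q1 qk1 section_sum_simps distrib_left distrib_right
    smult_add_right mult.commute)

text \<open>Factors C(x^k) pass through the section, and \<open>section_sum_hahn\<close> trades H_q
  for H_{q^k}, so the equation of \<open>v\<close> transfers to \<open>w\<close>.\<close>

lemma w_pcompose_hahn:
  assumes eq: "\<And>g. v (A * hahn (q ^ k) g) = - v (B * g)"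
  shows "w (pcompose A (monom 1 k) * hahn q f)
    = - q_number q k * w (monom 1 (k - 1) * pcompose B (monom 1 k) * f)"
proof -
  let ?E = "section_sum k (\<lambda>j. if j = k - 1 then 1 else (0::complex))"
  have comm: "w (pcompose C (monom 1 k) * g) = v (C * ?E g)" for C g
    using section_sum_mult_pcompose[OF k, of _ g C] by (simp add: w_def mult.commute)
  have "w (pcompose A (monom 1 k) * hahn q f)
      = q_number q k * v (A * hahn (q ^ k) (?E (monom 1 (k - 1) * f)))"
    by (simp add: comm section_sum_hahn[simplified] linear_functional_smult[OF v])
  also have "\<dots> = - q_number q k * w (pcompose B (monom 1 k) * (monom 1 (k - 1) * f))"
    by (simp add: eq comm)
  also have "pcompose B (monom 1 k) * (monom 1 (k - 1) * f)
      = monom 1 (k - 1) * pcompose B (monom 1 k) * f" by (simp only: ac_simps)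
  finally show ?thesis .
qed

text \<open>The equation of \<open>w\<close> is tested on \<tau> \<rho> f, where \<tau>(x) =
  \<rho>(x/q). Every resulting term carries the factor \<rho>, which \<open>u_eq_w\<close> absorbs;
  the cofactors are \<Phi> and \<Psi>.\<close>

lemma semiclassical_ascent:
  assumes p: "ops_wrt u p" "p 0 = 1" and "A \<noteq> 0"
    and eq: "\<And>g. v (A * hahn (q ^ k) g) = - v (B * g)"
    and deg: "degree A \<le> t + 2" "degree B \<le> t + 1" and k2: "k \<ge> 2"
  shows "\<exists>s \<le> (t + 3) * k - 3. hahn_semiclassical_ops q p s"
proof -
  define \<tau> where "\<tau> = pcompose \<rho> [:0, 1 / q:]"
  define \<sigma> where "\<sigma> = pcompose \<rho> [:0, q:]"
  define A' where "A' = pcompose A (monom 1 k)"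
  define B' where "B' = pcompose B (monom 1 k)"
  define \<Phi> where "\<Phi> = \<sigma> * A'"
  define \<Psi> where "\<Psi> = smult (q_number q k) (monom 1 (k - 1) * B' * \<tau>) + A' * (hahn q \<rho> + hahn q \<tau>)"
  have \<tau>_scale: "pcompose \<tau> [:0, q:] = \<rho>"
    unfolding \<tau>_def using q0 by (simp add: pcompose_assoc[symmetric] pcompose_pCons)
  have degs: "degree \<sigma> \<le> k - 1" "degree \<tau> \<le> k - 1"
    using degree_\<rho> by (simp_all add: \<sigma>_def \<tau>_def degree_pcompose)
  have degAB: "degree A' \<le> (t + 2) * k" "degree B' \<le> (t + 1) * k"
    using mult_right_mono[OF deg(1), of k] mult_right_mono[OF deg(2), of k]
    by (simp_all only: A'_def B'_def degree_pcompose degree_monom_eq one_neq_zero not_False_eq_True zero_le)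
  have "\<sigma> \<noteq> 0" "A' \<noteq> 0"
    using \<rho>_nonzero \<open>A \<noteq> 0\<close> q0 k unfolding \<sigma>_def A'_def
    by (auto simp: degree_monom_eq dest!: pcompose_eq_0)
  then have "\<Phi> \<noteq> 0" by (simp add: \<Phi>_def)
  moreover have "u (\<Phi> * hahn q f) = - u (\<Psi> * f)" for f
  proof -
    txt \<open>The factor \<open>\<tau>\<close> makes the \<open>H\<^sub>q\<close>-derivative below divisible by \<open>\<rho>\<close>.\<close>
    have "hahn q (\<tau> * \<rho> * f) = \<rho> * \<sigma> * hahn q f + \<rho> * (hahn q \<rho> + hahn q \<tau>) * f"
      unfolding hahn_mult_rule[OF q1, of "\<tau> * \<rho>" f] hahn_mult_rule[OF q1, of \<tau> \<rho>]
      by (simp add: pcompose_mult \<tau>_scale \<sigma>_def[symmetric] algebra_simps)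
    then have "\<rho> * (\<Phi> * hahn q f)
        = A' * hahn q (\<tau> * \<rho> * f) - \<rho> * (A' * (hahn q \<rho> + hahn q \<tau>) * f)"
      by (simp add: \<Phi>_def algebra_simps)
    then have "u (\<Phi> * hahn q f) = w (A' * hahn q (\<tau> * \<rho> * f))
        - w (\<rho> * (A' * (hahn q \<rho> + hahn q \<tau>) * f))"
      by (simp add: u_eq_w linear_functional_diff[OF linear_w])
    also have "w (A' * hahn q (\<tau> * \<rho> * f))
        = - w (smult (q_number q k) (monom 1 (k - 1) * B' * (\<tau> * \<rho> * f)))"
      unfolding A'_def B'_def w_pcompose_hahn[OF eq] by (simp add: linear_functional_smult[OF linear_w])
    also have "\<dots> - w (\<rho> * (A' * (hahn q \<rho> + hahn q \<tau>) * f)) = - w (\<rho> * (\<Psi> * f))"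
      by (simp add: \<Psi>_def algebra_simps linear_functional_simps[OF linear_w] smult_add_right)
    also have "\<dots> = - u (\<Psi> * f)" by (simp add: u_eq_w)
    finally show ?thesis .
  qed
  moreover have "degree \<Phi> \<le> (t + 3) * k - 3 + 2"
  proof -
    have "degree \<Phi> \<le> (k - 1) + (t + 2) * k"
      unfolding \<Phi>_def by (intro order_trans[OF degree_mult_le] add_mono degs degAB)
    also have "\<dots> = (t + 3) * k - 3 + 2" using k2 by (simp add: algebra_simps)
    finally show ?thesis .
  qed
  moreover have "degree \<Psi> \<le> (t + 3) * k - 3 + 1"
  proof -
    have "degree (monom 1 (k - 1) * B' * \<tau>) \<le> (k - 1) + (t + 1) * k + (k - 1)"
      by (intro order_trans[OF degree_mult_le] add_mono degs degAB degree_monom_le)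
    also have "\<dots> = (t + 3) * k - 3 + 1" using k2 by (simp add: algebra_simps)
    finally have 1: "degree (smult (q_number q k) (monom 1 (k - 1) * B' * \<tau>)) \<le> (t + 3) * k - 3 + 1"
      using degree_smult_le order_trans by blast
    \<comment> \<open>\<open>k \<ge> 2\<close> makes \<open>k - 2\<close> exact; both summands of
      \<Psi> then meet the same bound (t+3)k - 2.\<close>
    have "degree (hahn q \<rho>) \<le> k - 2" "degree (hahn q \<tau>) \<le> k - 2"
      using degree_hahn_le[OF q1, of \<rho>] degree_hahn_le[OF q1, of \<tau>] degree_\<rho> degs by linarith+
    then have "degree (A' * (hahn q \<rho> + hahn q \<tau>)) \<le> (t + 2) * k + (k - 2)"
      by (intro order_trans[OF degree_mult_le] add_mono degAB degree_add_le)
    also have "\<dots> = (t + 3) * k - 3 + 1" using k2 by (simp add: algebra_simps)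
    finally show ?thesis unfolding \<Psi>_def using 1 by (intro degree_add_le)
  qed
  ultimately show ?thesis by (rule hahn_semiclassical_opsI[OF q p])
qed

end

section \<open>Passage from the orthogonal sequences to the functionals, and conclusion\<close>

lemma power_related_functionalsI:
  fixes P Q :: "nat \<Rightarrow> complex poly"
  assumes k: "k > 0" and q: "q \<noteq> 0" "\<forall>n\<ge>1. q ^ n \<noteq> 1"
    and P: "ops_wrt u P" "P 0 = 1" and Q: "ops_wrt v Q" "Q 0 = 1"
    and PQ: "\<And>n. P (n * k) = pcompose (Q n) (monom 1 k)"
  shows "\<exists>c. power_related_functionals k q c u v"
proof -
  note lin = ops_wrtD(1)[OF P(1)]
  define c where "c j = u (monom 1 j) / v 1" for j
  have "u (monom 1 j * pcompose g (monom 1 k)) = c j * v g" if j: "j < k" for j g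
  proof -
    define L where "L f = u (monom 1 j * pcompose f (monom 1 k))" for f
    have "linear_functional L"
      by (simp add: linear_functional_iff L_def pcompose_add pcompose_smult distrib_left
          linear_functional_simps[OF lin])
    moreover have "L (Q n) = 0" if "n \<noteq> 0" for n
    proof -
      \<comment> \<open>Thus x^j is orthogonal to P_{nk} = Q_n(x^k), so \<open>L\<close> kills every
        \<open>Q n\<close> with \<open>n \<noteq> 0\<close> and is a multiple of
        \<open>v\<close>.\<close>
      have "j < n * k" using j that by (cases n) simp_all
      then have "degree (monom (1::complex) j) < n * k" by (simp add: degree_monom_eq)
      from ops_wrt_orthogonal[OF P(1) this] show ?thesis by (simp add: L_def PQ)
    qed
    ultimately have "L g = L 1 / v 1 * v g"
      by (rule ops_wrt_functional_unique[OF Q])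
    then show ?thesis by (simp add: L_def c_def pcompose_1)
  qed
  moreover have "c 0 \<noteq> 0"
    using ops_wrt_zeroth[OF P] ops_wrt_zeroth[OF Q] by (simp add: c_def)
  ultimately have "power_related_functionals k q c u v"
    using k q lin ops_wrtD(1)[OF Q(1)] by (simp add: power_related_functionals_def)
  then show ?thesis by blast
qed

lemma monic_ops_zeroth: "monic_ops p \<Longrightarrow> p 0 = 1"
  unfolding monic_ops_def is_ops_def ops_wrt_def
  by (metis degree_eq_zeroE lead_coeff_pCons(2) one_pCons)

theorem theorem3p5:
  fixes k :: nat and q :: complex and P Q :: "nat \<Rightarrow> complex poly"
  assumes "k \<ge> 2"
    and "q \<noteq> 0"
    and "\<forall>n\<ge>1. q ^ n \<noteq> 1"
    and "monic_ops P"
    and "monic_ops Q"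
    and "\<forall>n. P (n * k) = pcompose (Q n) (monom 1 k)"
  shows "(\<forall>s. hahn_semiclassical_ops q P s \<longrightarrow>
            (\<exists>t. hahn_semiclassical_ops (q ^ k) Q t \<and> int t \<le> \<lfloor>real s / real k\<rfloor>)) \<and>
         (\<forall>t. hahn_semiclassical_ops (q ^ k) Q t \<longrightarrow>
            (\<exists>s. hahn_semiclassical_ops q P s \<and> int s \<le> (int t + 3) * int k - 3))"
proof (intro conjI allI impI)
  note P0 = monic_ops_zeroth[OF assms(4)] and Q0 = monic_ops_zeroth[OF assms(5)]
  have k: "k > 0" using assms(1) by simp
  note related = power_related_functionalsI[OF k assms(2,3) _ P0 _ Q0 assms(6)[rule_format]]
  {
    fix s assume "hahn_semiclassical_ops q P s"
    then obtain u where u_ops: "ops_wrt u P"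
      and semi: "hahn_semiclassical q u" and s: "hahn_class q u = s"
      by (auto simp: hahn_semiclassical_ops_def)
    \<comment> \<open>Any functional for \<open>Q\<close> serves here: a rescaling of
      \<open>v\<close> is absorbed by the constants \<open>c\<close>.\<close>
    obtain v where v_ops: "ops_wrt v Q" using assms(5) by (auto simp: monic_ops_def is_ops_def)
    obtain c where "power_related_functionals k q c u v" using related[OF u_ops v_ops] by blast
    then interpret power_related_functionals k q c u v .
    obtain \<Phi> \<Psi> where "hahn_pair q u \<Phi> \<Psi>" "degree \<Phi> \<le> s + 2" "degree \<Psi> \<le> s + 1"
      using hahn_class_witness[OF semi] s by blast
    then obtain t where "t \<le> s div k" "hahn_semiclassical_ops (q ^ k) Q t"
      using semiclassical_descent[OF u_ops v_ops Q0, of \<Phi> \<Psi> s] by (auto simp: hahn_pair_iff)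
    then show "\<exists>t. hahn_semiclassical_ops (q ^ k) Q t \<and> int t \<le> \<lfloor>real s / real k\<rfloor>"
      by (intro exI[of _ t]) (simp add: floor_divide_of_nat_eq flip: zdiv_int)
  next
    fix t assume "hahn_semiclassical_ops (q ^ k) Q t"
    then obtain v where v_ops: "ops_wrt v Q"
      and semi: "hahn_semiclassical (q ^ k) v" and t: "hahn_class (q ^ k) v = t"
      by (auto simp: hahn_semiclassical_ops_def)
    obtain u where u_ops: "ops_wrt u P" using assms(4) by (auto simp: monic_ops_def is_ops_def)
    obtain c where "power_related_functionals k q c u v" using related[OF u_ops v_ops] by blast
    then interpret power_related_functionals k q c u v .
    obtain A B where "hahn_pair (q ^ k) v A B" "degree A \<le> t + 2" "degree B \<le> t + 1"
      using hahn_class_witness[OF semi] t by blast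
    then obtain s where s: "s \<le> (t + 3) * k - 3" "hahn_semiclassical_ops q P s"
      using semiclassical_ascent[OF u_ops P0, of A B t] assms(1) by (auto simp: hahn_pair_iff)
    \<comment> \<open>The subtraction of 3 in the bound on \<open>s\<close> is therefore exact,
      which the passage to the integers requires.\<close>
    have "3 \<le> (t + 3) * k" using k by (cases k) simp_all
    with s(1) have "s + 3 \<le> (t + 3) * k" by linarith
    then have "int (s + 3) \<le> int ((t + 3) * k)" by (simp only: of_nat_le_iff)
    with s(2) show "\<exists>s. hahn_semiclassical_ops q P s \<and> int s \<le> (int t + 3) * int k - 3"
      by (intro exI[of _ s]) (simp add: algebra_simps)
  }
qed

end
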